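(* For every $n\ge1$ and $c\in\mathbb Z$, $$f(n,c,x)=\sum_{i=1}^{n}x^{\Delta(n,c,i)}\,f\bigl(i-1,c-(n-i),x\bigr)\,f(n-i,c+i,x),$$ where $$\Delta(n,c,i)=\begin{cases}1,& n\in\{c+1,\ldots,c+i-1\},\\ 0,&\text{otherwise},\end{cases}$$ with initial condition $f(0,c,x)=1$. In particular, $f_{132}(n,x)=f(n,0,x)$.
   Context: $\mathfrak S_n$ is the set of permutations of $\{1,\dots,n\}$ and $\operatorname{Av}_n(132)$ is the set of $\pi\in\mathfrak S_n$ with no subsequence order-isomorphic to $132$. $\operatorname{DD}(\pi)$ is the number of indices $k$ with $\pi(k)<k<\pi^{-1}(k)$ (double deficiencies), and $f_{132}(n,x)=\sum_{\pi\in\operatorname{Av}_n(132)}x^{\operatorname{DD}(\pi)}$. For $\pi\in\mathfrak S_n$ and $c\in\mathbb Z$, the number of shifted double deficiencies of $\pi$ with shift $c$ is $$\operatorname{DD}_c(\pi)=\#\{j\in\{1,\ldots,n\}: 1\le j+c\le n,\ \pi(j)<j+c<\pi^{-1}(j+c)+c\}.$$ For $n\ge 0$ and $c\in\mathbb Z$, $f(n,c,x)=\sum_{\pi\in\operatorname{Av}_n(132)}x^{\operatorname{DD}_c(\pi)}$. The set $\{c+1,\ldots,c+i-1\}$ is empty when $i=1$. *)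

theory Defs
  imports
    "HOL-Combinatorics.Permutations"
    "HOL-Computational_Algebra.Polynomial"
    "HOL-Library.Sublist"
begin

text \<open>
  A permutation of \<open>{1..n}\<close> is a function on the integers that permutes \<open>{1..int n}\<close>;
  integers rather than naturals, so that positions and values can be shifted by a
  negative amount without truncation.
\<close>

definition order_isomorphic :: "int list \<Rightarrow> int list \<Rightarrow> bool" where
  "order_isomorphic us vs \<longleftrightarrow>
     length us = length vs \<and>
     (\<forall>a<length us. \<forall>b<length us. us ! a < us ! b \<longleftrightarrow> vs ! a < vs ! b)"

definition contains_pattern :: "nat \<Rightarrow> (int \<Rightarrow> int) \<Rightarrow> int list \<Rightarrow> bool" where
  "contains_pattern n \<pi> \<sigma> \<longleftrightarrow>
     (\<exists>us. subseq us (map \<pi> [1..int n]) \<and> order_isomorphic us \<sigma>)"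

definition Av132 :: "nat \<Rightarrow> (int \<Rightarrow> int) set" where
  "Av132 n = {\<pi>. \<pi> permutes {1..int n} \<and> \<not> contains_pattern n \<pi> [1, 3, 2]}"

definition DD :: "nat \<Rightarrow> (int \<Rightarrow> int) \<Rightarrow> nat" where
  "DD n \<pi> = card {k \<in> {1..int n}. \<pi> k < k \<and> k < inv \<pi> k}"

definition DD_shift :: "nat \<Rightarrow> int \<Rightarrow> (int \<Rightarrow> int) \<Rightarrow> nat" where
  "DD_shift n c \<pi> =
     card {j \<in> {1..int n}. 1 \<le> j + c \<and> j + c \<le> int n \<and>
                            \<pi> j < j + c \<and> j + c < inv \<pi> (j + c) + c}"

text \<open>The generating functions are polynomials in the indeterminate \<open>x\<close>, written \<open>[:0, 1:]\<close>.\<close>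

definition f132 :: "nat \<Rightarrow> int poly" where
  "f132 n = (\<Sum>\<pi>\<in>Av132 n. [:0, 1:] ^ DD n \<pi>)"

definition f_shift :: "nat \<Rightarrow> int \<Rightarrow> int poly" where
  "f_shift n c = (\<Sum>\<pi>\<in>Av132 n. [:0, 1:] ^ DD_shift n c \<pi>)"

definition Delta :: "nat \<Rightarrow> int \<Rightarrow> nat \<Rightarrow> nat" where
  "Delta n c i = (if int n \<in> {c + 1..c + int i - 1} then 1 else 0)"

end

theory Submission
  imports Defs
begin

text \<open>
  The recurrence comes from cutting a 132-avoiding permutation \<open>\<pi>\<close> of \<open>{1..n}\<close> at its maximum.
  If \<open>\<pi> i = n\<close>, every value to the left of position \<open>i\<close> must exceed every value to its right, since
  otherwise the two values together with \<open>n\<close> would form a 132. So the left part is a 132-avoiding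
  permutation \<open>\<sigma>\<close> of length \<open>p = i - 1\<close> raised by \<open>q = n - i\<close>, the right part is a 132-avoiding
  permutation \<open>\<tau>\<close> of length \<open>q\<close> moved to the right by \<open>i\<close>, and conversely every such pair can be
  glued (\<open>bij_betw_glue\<close>).

  A shifted double deficiency is best seen as a cell \<open>(j, v)\<close> on the diagonal \<open>v = j + c\<close> of the
  permutation diagram, such that \<open>\<pi> j < v\<close> and \<open>v\<close> occurs to the right of \<open>j\<close>. The
  condition at a cell depends only on the relative order of \<open>v\<close> and \<open>\<pi> j\<close> and of \<open>j\<close> and the
  position of \<open>v\<close>, so it is preserved when a block is translated. In the block of \<open>\<sigma>\<close> the
  diagonal has shift \<open>c - q\<close>, in the block of \<open>\<tau>\<close> it has shift \<open>c + i\<close>. The two off-diagonal blocks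
  contribute nothing: below \<open>\<sigma>\<close> the value at position \<open>j\<close> is too large, and above \<open>\<tau>\<close> the value
  \<open>v\<close> occurs too far to the left. A cell in column \<open>i\<close> never counts, because the
  value \<open>n\<close> there is not below any row. Finally a cell \<open>(j, n)\<close> always counts when \<open>j < i\<close> and never otherwise; the
  diagonal meets row \<open>n\<close> at \<open>j = n - c\<close>, and \<open>1 \<le> n - c \<le> i - 1\<close> is the condition in
  \<open>Delta n c i\<close>. Hence the statistic is additive under gluing up to that term
  (\<open>DD_shift_glue\<close>), and summing over the position of the maximum gives the recurrence.
\<close>

section \<open>Avoiding 132 in terms of positions\<close>

lemma contains_132_iff:
  "contains_pattern n \<pi> [1, 3, 2] \<longleftrightarrow>
     (\<exists>a b c. 1 \<le> a \<and> a < b \<and> b < c \<and> c \<le> int n \<and> \<pi> a < \<pi> c \<and> \<pi> c < \<pi> b)"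
    (is "?L \<longleftrightarrow> ?R")
proof
  assume ?L
  then obtain us where us: "subseq us (map \<pi> [1..int n])" "order_isomorphic us [1, 3, 2]"
    unfolding contains_pattern_def by blast
  from us(1) obtain N where "us = map \<pi> (nths [1..int n] N)"
    by (auto simp: subseq_conv_nths nths_map)
  moreover obtain ws where ws: "ws = nths [1..int n] N" by simp
  ultimately have u: "us = map \<pi> ws" by simp
  from us(2) have len: "length us = 3" by (simp add: order_isomorphic_def)
  with u obtain a b c where abc: "ws = [a, b, c]"
    by (auto simp: numeral_3_eq_3 length_Suc_conv)
  have "sorted ws" "distinct ws" by (simp_all add: ws sorted_nths)
  \<comment> \<open>A selection from the list of positions inherits its strict order.\<close>
  with abc have "a < b" "b < c" by auto
  moreover have "set ws \<subseteq> {1..int n}" by (metis ws set_nths_subset set_upto)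
  moreover have "\<pi> a < \<pi> c" "\<pi> c < \<pi> b"
    using us(2) unfolding u abc order_isomorphic_def
    by (force dest: spec[of _ 0] spec[of _ 2] spec[of _ 1] simp: numeral_2_eq_2 numeral_3_eq_3)+
  ultimately show ?R using abc by auto
next
  assume ?R
  then obtain a b c where
    h: "1 \<le> a" "a < b" "b < c" "c \<le> int n" "\<pi> a < \<pi> c" "\<pi> c < \<pi> b" by blast
  have "[1..int n] = [1..a-1] @ a # [a+1..b-1] @ b # [b+1..c-1] @ c # [c+1..int n]"
    using h upto_split3[of 1 a "int n"] upto_split3[of "a+1" b "int n"]
      upto_split3[of "b+1" c "int n"] by simp
  moreover have "subseq [a, b, c] \<dots>"
    by (simp add: list_emb_append2 subseq_drop_many)
  ultimately have "subseq [\<pi> a, \<pi> b, \<pi> c] (map \<pi> [1..int n])"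
    using subseq_map[of "[a, b, c]" "[1..int n]" \<pi>] by simp
  moreover have "order_isomorphic [\<pi> a, \<pi> b, \<pi> c] [1, 3, 2]"
    using h by (auto simp: order_isomorphic_def less_Suc_eq numeral_3_eq_3)
  ultimately show ?L unfolding contains_pattern_def by blast
qed

lemma Av132_iff:
  "\<pi> \<in> Av132 n \<longleftrightarrow> \<pi> permutes {1..int n} \<and>
     (\<forall>a b c. 1 \<le> a \<longrightarrow> a < b \<longrightarrow> b < c \<longrightarrow> c \<le> int n \<longrightarrow> \<pi> a < \<pi> c \<longrightarrow> \<pi> b \<le> \<pi> c)"
  unfolding Av132_def contains_132_iff mem_Collect_eq not_less[symmetric] by blast

lemma Av132_permutes: "\<pi> \<in> Av132 n \<Longrightarrow> \<pi> permutes {1..int n}"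
  by (simp add: Av132_def)

lemma permutes_atLeastAtMost_bounds:
  fixes \<pi> :: "int \<Rightarrow> int"
  assumes "\<pi> permutes {1..m}" "1 \<le> j" "j \<le> m"
  shows "1 \<le> \<pi> j" "\<pi> j \<le> m"
  using permutes_in_image[OF assms(1), of j] assms(2,3) by auto

lemma finite_Av132: "finite (Av132 n)"
  by (rule finite_subset[OF _ finite_permutations[of "{1..int n}"]]) (auto simp: Av132_def)

section \<open>Gluing two permutations around the maximum\<close>

text \<open>
  The middle case puts the maximum at position \<open>p + 1\<close>. Writing the length as \<open>p + q + 1\<close>, rather
  than fixing it together with the position of the maximum, avoids truncated subtraction.
\<close>

definition glue :: "nat \<Rightarrow> nat \<Rightarrow> (int \<Rightarrow> int) \<Rightarrow> (int \<Rightarrow> int) \<Rightarrow> int \<Rightarrow> int" where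
  "glue p q \<sigma> \<tau> j =
     (if 1 \<le> j \<and> j \<le> int p then \<sigma> j + int q
      else if j = int p + 1 then int p + int q + 1
      else if int p + 1 < j \<and> j \<le> int p + int q + 1 then \<tau> (j - int p - 1)
      else j)"

lemma glue_permutes:
  assumes s: "\<sigma> permutes {1..int p}" and t: "\<tau> permutes {1..int q}"
  shows "glue p q \<sigma> \<tau> permutes {1..int (p + q + 1)}"
proof (rule inj_imp_permutes)
  note sb = permutes_atLeastAtMost_bounds[OF s] and tb = permutes_atLeastAtMost_bounds[OF t]
  show "glue p q \<sigma> \<tau> j \<in> {1..int (p + q + 1)}" if "j \<in> {1..int (p + q + 1)}" for j
    using that sb[of j] tb[of "j - int p - 1"] by (auto simp: glue_def)
  show "inj_on (glue p q \<sigma> \<tau>) {1..int (p + q + 1)}"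
  proof (rule inj_onI)
    fix j k assume j: "j \<in> {1..int (p + q + 1)}" and k: "k \<in> {1..int (p + q + 1)}"
      and e: "glue p q \<sigma> \<tau> j = glue p q \<sigma> \<tau> k"
    note [simp] = inj_eq[OF permutes_inj[OF s]] inj_eq[OF permutes_inj[OF t]]
    show "j = k"
      using j k e sb[of j] tb[of "j - int p - 1"] sb[of k] tb[of "k - int p - 1"]
      by (auto simp: glue_def split: if_splits)
  qed
qed (auto simp: glue_def)

text \<open>
  In a 132 at positions \<open>a < b < c\<close>, the entry at \<open>c\<close> exceeds the one at \<open>a\<close> and is not the
  maximum. Since every value of the left block exceeds every value of the right block, \<open>a\<close> and \<open>c\<close>
  lie in the same block, and the pattern would already occur in \<open>\<sigma>\<close> or \<open>\<tau>\<close>.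
\<close>

lemma glue_Av132:
  assumes s: "\<sigma> \<in> Av132 p" and t: "\<tau> \<in> Av132 q"
  shows "glue p q \<sigma> \<tau> \<in> Av132 (p + q + 1)"
  unfolding Av132_iff
proof (intro conjI allI impI)
  note sp = Av132_permutes[OF s] and tp = Av132_permutes[OF t]
  show "glue p q \<sigma> \<tau> permutes {1..int (p + q + 1)}"
    by (rule glue_permutes[OF sp tp])
  fix a b c
  assume h: "1 \<le> a" "a < b" "b < c" "c \<le> int (p + q + 1)" "glue p q \<sigma> \<tau> a < glue p q \<sigma> \<tau> c"
  note sb = permutes_atLeastAtMost_bounds[OF sp] and tb = permutes_atLeastAtMost_bounds[OF tp]
  consider "c \<le> int p" | "int p + 1 \<le> c" "a \<le> int p + 1" | "int p + 1 < a" by linarith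
  then show "glue p q \<sigma> \<tau> b \<le> glue p q \<sigma> \<tau> c"
  proof cases
    case 1
    then show ?thesis using s h by (auto simp: Av132_iff glue_def)
  next
    case 2
    then show ?thesis
      using h sb[of a] sb[of b] tb[of "c - int p - 1"] by (auto simp: glue_def split: if_splits)
  next
    case 3
    then have "\<tau> (b - int p - 1) \<le> \<tau> (c - int p - 1)"
      using t[unfolded Av132_iff, THEN conjunct2, rule_format,
          of "a - int p - 1" "b - int p - 1" "c - int p - 1"] h
      by (auto simp: glue_def)
    then show ?thesis using 3 h by (auto simp: glue_def)
  qed
qed

text \<open>
  Avoidance only says that the values \<open>A\<close> on the left lie above the values \<open>B\<close> on the right;
  counting then identifies both sets. As \<open>B\<close> is downward closed in \<open>{1..p + q}\<close> and has \<open>q\<close>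
  elements, none of them exceeds \<open>q\<close>, and dually for \<open>A\<close>.
\<close>

lemma Av132_around_max:
  assumes \<pi>: "\<pi> \<in> Av132 (p + q + 1)" and max: "\<pi> (int p + 1) = int (p + q + 1)"
  shows "1 \<le> j \<Longrightarrow> j \<le> int p \<Longrightarrow> int q < \<pi> j \<and> \<pi> j \<le> int (p + q)"
    and "int p + 1 < j \<Longrightarrow> j \<le> int (p + q + 1) \<Longrightarrow> 1 \<le> \<pi> j \<and> \<pi> j \<le> int q"
proof -
  note perm = Av132_permutes[OF \<pi>]
  note bnd = permutes_atLeastAtMost_bounds[OF perm]
  note inj = inj_eq[OF permutes_inj[OF perm]]
  define A where "A = \<pi> ` {1..int p}"
  define B where "B = \<pi> ` {int p + 2..int (p + q + 1)}"
  have cA: "card A = p" "finite A" and cB: "card B = q" "finite B"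
    by (auto simp: A_def B_def card_image permutes_inj_on[OF perm])
  have lt: "\<pi> j \<noteq> int (p + q + 1)" if "j \<noteq> int p + 1" for j
    using that inj[of j "int p + 1"] max by auto
  have "{1..int (p + q + 1)} = insert (int p + 1) ({1..int p} \<union> {int p + 2..int (p + q + 1)})"
    by auto
  then have "\<pi> ` {1..int (p + q + 1)} = insert (int (p + q + 1)) (A \<union> B)"
    by (simp only: A_def B_def image_Un image_insert max)
  then have "{1..int (p + q + 1)} = insert (int (p + q + 1)) (A \<union> B)"
    by (simp only: permutes_image[OF perm])
  moreover have "int (p + q + 1) \<notin> A \<union> B"
  proof -
    have "j \<noteq> int p + 1" if "j \<in> {1..int p} \<union> {int p + 2..int (p + q + 1)}" for j
      using that by auto
    with lt show ?thesis unfolding A_def B_def image_Un[symmetric] by (metis imageE)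
  qed
  ultimately have "A \<union> B = {1..int (p + q + 1)} - {int (p + q + 1)}"
    by blast
  also have "\<dots> = {1..int (p + q)}" by auto
  finally have AB: "A \<union> B = {1..int (p + q)}" .
  have gt: "v < u" if "u \<in> A" "v \<in> B" for u v
  proof -
    from that obtain a b where ab: "u = \<pi> a" "v = \<pi> b" "1 \<le> a" "a \<le> int p"
      "int p + 2 \<le> b" "b \<le> int (p + q + 1)" by (auto simp: A_def B_def)
    have "\<not> \<pi> a < \<pi> b"
    proof
      assume "\<pi> a < \<pi> b"
      then have "\<pi> (int p + 1) \<le> \<pi> b"
        using \<pi>[unfolded Av132_iff, THEN conjunct2, rule_format, of a "int p + 1" b] ab by auto
      then show False using max lt[of b] bnd[of b] ab by auto
    qed
    moreover have "\<pi> a \<noteq> \<pi> b" using inj ab by auto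
    ultimately show ?thesis using ab by simp
  qed
  have B: "v \<le> int q" if "v \<in> B" for v
  proof -
    have "{1..v} \<subseteq> B"
    proof
      fix w assume "w \<in> {1..v}"
      moreover have "v \<in> {1..int (p + q)}" using that AB by blast
      ultimately have "w \<in> A \<union> B" "w \<le> v" by (auto simp only: AB atLeastAtMost_iff)
      with gt[of w v] that show "w \<in> B" by auto
    qed
    from card_mono[OF cB(2) this] show ?thesis using cB(1) by simp
  qed
  have A: "int q < u" if "u \<in> A" for u
  proof -
    have "{u..int (p + q)} \<subseteq> A"
    proof
      fix w assume "w \<in> {u..int (p + q)}"
      moreover have "u \<in> {1..int (p + q)}" using that AB by blast
      ultimately have "w \<in> A \<union> B" "u \<le> w" by (auto simp only: AB atLeastAtMost_iff)
      with gt[of u w] that show "w \<in> A" by auto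
    qed
    from card_mono[OF cA(2) this] show ?thesis using cA(1) by simp
  qed
  show "1 \<le> j \<Longrightarrow> j \<le> int p \<Longrightarrow> int q < \<pi> j \<and> \<pi> j \<le> int (p + q)"
    using A[of "\<pi> j"] AB by (auto simp: A_def set_eq_iff)
  show "int p + 1 < j \<Longrightarrow> j \<le> int (p + q + 1) \<Longrightarrow> 1 \<le> \<pi> j \<and> \<pi> j \<le> int q"
    using B[of "\<pi> j"] bnd[of j] by (auto simp: B_def)
qed

text \<open>
  Both parts are extended by the identity, so that they are permutations in the sense of
  \<open>permutes\<close> and undo gluing as functions on all integers.
\<close>

definition left_part :: "nat \<Rightarrow> nat \<Rightarrow> (int \<Rightarrow> int) \<Rightarrow> int \<Rightarrow> int" where
  "left_part p q \<pi> j = (if 1 \<le> j \<and> j \<le> int p then \<pi> j - int q else j)"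

definition right_part :: "nat \<Rightarrow> nat \<Rightarrow> (int \<Rightarrow> int) \<Rightarrow> int \<Rightarrow> int" where
  "right_part p q \<pi> j = (if 1 \<le> j \<and> j \<le> int q then \<pi> (j + int p + 1) else j)"

lemma parts_Av132:
  assumes \<pi>: "\<pi> \<in> Av132 (p + q + 1)" and max: "\<pi> (int p + 1) = int (p + q + 1)"
  shows "left_part p q \<pi> \<in> Av132 p" and "right_part p q \<pi> \<in> Av132 q"
proof -
  note inj = inj_eq[OF permutes_inj[OF Av132_permutes[OF \<pi>]]]
  note L = Av132_around_max(1)[OF \<pi> max] and R = Av132_around_max(2)[OF \<pi> max]
  note av = \<pi>[unfolded Av132_iff, THEN conjunct2, rule_format]
  have "left_part p q \<pi> permutes {1..int p}"
  proof (rule inj_imp_permutes)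
    show "inj_on (left_part p q \<pi>) {1..int p}"
      by (auto simp: inj_on_def left_part_def inj)
    show "left_part p q \<pi> j \<in> {1..int p}" if "j \<in> {1..int p}" for j
      using that L[of j] by (auto simp: left_part_def)
  qed (auto simp: left_part_def)
  then show "left_part p q \<pi> \<in> Av132 p"
    unfolding Av132_iff using av by (auto simp: left_part_def)
  have "right_part p q \<pi> permutes {1..int q}"
  proof (rule inj_imp_permutes)
    show "inj_on (right_part p q \<pi>) {1..int q}"
      by (auto simp: inj_on_def right_part_def inj)
    show "right_part p q \<pi> j \<in> {1..int q}" if "j \<in> {1..int q}" for j
      using that R[of "j + int p + 1"] by (auto simp: right_part_def)
  qed (auto simp: right_part_def)
  then show "right_part p q \<pi> \<in> Av132 q"
    unfolding Av132_iff
  proof (intro conjI allI impI)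
    fix a b c
    assume "1 \<le> a" "a < b" "b < c" "c \<le> int q" "right_part p q \<pi> a < right_part p q \<pi> c"
    then show "right_part p q \<pi> b \<le> right_part p q \<pi> c"
      using av[of "a + int p + 1" "b + int p + 1" "c + int p + 1"] by (simp add: right_part_def)
  qed
qed

lemma bij_betw_glue:
  "bij_betw (\<lambda>(\<sigma>, \<tau>). glue p q \<sigma> \<tau>) (Av132 p \<times> Av132 q)
     {\<pi> \<in> Av132 (p + q + 1). \<pi> (int p + 1) = int (p + q + 1)}"
proof (rule bij_betw_byWitness[where f' = "\<lambda>\<pi>. (left_part p q \<pi>, right_part p q \<pi>)"])
  show "\<forall>x\<in>Av132 p \<times> Av132 q. (\<lambda>\<pi>. (left_part p q \<pi>, right_part p q \<pi>))
          ((\<lambda>(\<sigma>, \<tau>). glue p q \<sigma> \<tau>) x) = x"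
  proof (clarsimp, intro conjI ext)
    fix \<sigma> \<tau> j assume s: "\<sigma> \<in> Av132 p" and t: "\<tau> \<in> Av132 q"
    show "left_part p q (glue p q \<sigma> \<tau>) j = \<sigma> j"
      using permutes_not_in[OF Av132_permutes[OF s], of j] by (auto simp: left_part_def glue_def)
    show "right_part p q (glue p q \<sigma> \<tau>) j = \<tau> j"
      using permutes_not_in[OF Av132_permutes[OF t], of j] by (auto simp: right_part_def glue_def)
  qed
  show "\<forall>\<pi>\<in>{\<pi> \<in> Av132 (p + q + 1). \<pi> (int p + 1) = int (p + q + 1)}.
          (\<lambda>(\<sigma>, \<tau>). glue p q \<sigma> \<tau>) (left_part p q \<pi>, right_part p q \<pi>) = \<pi>"
  proof (clarsimp, intro ext)
    fix \<pi> j assume \<pi>: "\<pi> \<in> Av132 (Suc (p + q))" and max: "\<pi> (int p + 1) = 1 + (int p + int q)"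
    show "glue p q (left_part p q \<pi>) (right_part p q \<pi>) j = \<pi> j"
      using max permutes_not_in[OF Av132_permutes[OF \<pi>], of j]
      by (auto simp: left_part_def right_part_def glue_def)
  qed
  show "(\<lambda>(\<sigma>, \<tau>). glue p q \<sigma> \<tau>) ` (Av132 p \<times> Av132 q)
          \<subseteq> {\<pi> \<in> Av132 (p + q + 1). \<pi> (int p + 1) = int (p + q + 1)}"
    using glue_Av132 by (auto simp: glue_def)
  show "(\<lambda>\<pi>. (left_part p q \<pi>, right_part p q \<pi>)) `
          {\<pi> \<in> Av132 (p + q + 1). \<pi> (int p + 1) = int (p + q + 1)} \<subseteq> Av132 p \<times> Av132 q"
    using parts_Av132 by blast
qed

section \<open>Shifted double deficiencies of a glued permutation\<close>

text \<open>
  Each cell \<open>(j, j + c)\<close> is classified by its column (left of, at, or right of position \<open>p + 1\<close>) and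
  its row (at most \<open>q\<close>, between \<open>q\<close> and the maximum, or the maximum itself). Only the two diagonal
  blocks and the part of the top row to the left of the maximum contribute.
\<close>

lemma DD_shift_glue:
  assumes s: "\<sigma> permutes {1..int p}" and t: "\<tau> permutes {1..int q}"
  shows "DD_shift (p + q + 1) c (glue p q \<sigma> \<tau>) =
    Delta (p + q + 1) c (p + 1) + DD_shift p (c - int q) \<sigma> + DD_shift q (c + int p + 1) \<tau>"
proof -
  let ?n = "int (p + q + 1)"
  let ?g = "glue p q \<sigma> \<tau>"
  note g = glue_permutes[OF s t]
  note sb = permutes_atLeastAtMost_bounds[OF s] and tb = permutes_atLeastAtMost_bounds[OF t]
  note sb' = permutes_atLeastAtMost_bounds[OF permutes_inv[OF s]]
    and tb' = permutes_atLeastAtMost_bounds[OF permutes_inv[OF t]]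
  have inv_left: "inv ?g v = inv \<sigma> (v - int q)" if "int q < v" "v \<le> int (p + q)" for v
    using that sb'[of "v - int q"] permutes_inverses(1)[OF s]
    by (simp add: permutes_inv_eq[OF g] glue_def)
  have inv_max: "inv ?g ?n = int p + 1"
    by (simp add: permutes_inv_eq[OF g] glue_def)
  have inv_right: "inv ?g v = inv \<tau> v + int p + 1" if "1 \<le> v" "v \<le> int q" for v
    using that tb'[of v] permutes_inverses(1)[OF t]
    by (simp add: permutes_inv_eq[OF g] glue_def)
  define S where "S m d \<rho> = {j \<in> {1..int m}. 1 \<le> j + d \<and> j + d \<le> int m \<and>
      \<rho> j < j + d \<and> j + d < inv \<rho> (j + d) + d}" for m d \<rho>
  \<comment> \<open>The cell in the top row: at most one, and counted by \<open>Delta\<close>.\<close>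
  define M where "M = {j. j = ?n - c \<and> 1 \<le> j \<and> j \<le> int p}"
  have mem: "j \<in> S (p + q + 1) c ?g \<longleftrightarrow>
      j \<in> M \<or> j \<in> S p (c - int q) \<sigma> \<or> j - int p - 1 \<in> S q (c + int p + 1) \<tau>" for j
  proof -
    have "j < 1 \<or> ?n < j \<or> (1 \<le> j \<and> j \<le> int p) \<or> j = int p + 1 \<or> (int p + 1 < j \<and> j \<le> ?n)"
      and "j + c < 1 \<or> ?n < j + c \<or> (1 \<le> j + c \<and> j + c \<le> int q) \<or>
        (int q < j + c \<and> j + c \<le> int (p + q)) \<or> j + c = ?n"
      by auto
    then consider "j < 1 \<or> ?n < j \<or> j + c < 1 \<or> ?n < j + c"
      | "1 \<le> j" "j \<le> int p" "1 \<le> j + c" "j + c \<le> int q"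
      | "1 \<le> j" "j \<le> int p" "int q < j + c" "j + c \<le> int (p + q)"
      | "1 \<le> j" "j \<le> int p" "j + c = ?n"
      | "j = int p + 1"
      | "int p + 1 < j" "j \<le> ?n" "1 \<le> j + c" "j + c \<le> int q"
      | "int p + 1 < j" "j \<le> ?n" "int q < j + c" "j + c \<le> int (p + q)"
      | "int p + 1 < j" "j \<le> ?n" "j + c = ?n"
      by blast
    then show ?thesis
    proof cases
      case 1
      then show ?thesis by (auto simp: S_def M_def)
    next
      case 2
      then show ?thesis using sb[of j] by (auto simp: S_def M_def glue_def)
    next
      case 3
      then show ?thesis using inv_left[of "j + c"]
        by (auto simp: S_def M_def glue_def algebra_simps)
    next
      case 4
      then show ?thesis using inv_max sb[of j]
        by (auto simp: S_def M_def glue_def algebra_simps)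
    next
      case 5
      then show ?thesis by (auto simp: S_def M_def glue_def)
    next
      case 6
      then show ?thesis using inv_right[of "j + c"]
        by (auto simp: S_def M_def glue_def algebra_simps)
    next
      case 7
      then show ?thesis using inv_left[of "j + c"] sb'[of "j + c - int q"]
        by (auto simp: S_def M_def)
    next
      case 8
      then show ?thesis using inv_max by (auto simp: S_def M_def)
    qed
  qed
  let ?R = "(\<lambda>j. j + int p + 1) ` S q (c + int p + 1) \<tau>"
  have "S (p + q + 1) c ?g = (M \<union> S p (c - int q) \<sigma>) \<union> ?R"
  proof -
    have "j \<in> ?R \<longleftrightarrow> j - int p - 1 \<in> S q (c + int p + 1) \<tau>" for j
    proof
      assume "j - int p - 1 \<in> S q (c + int p + 1) \<tau>"
      from imageI[OF this, of "\<lambda>j. j + int p + 1"] show "j \<in> ?R" by simp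
    qed auto
    with mem show ?thesis by blast
  qed
  moreover have fin: "finite (S m d \<rho>)" for m d \<rho>
    by (rule finite_subset[of _ "{1..int m}"]) (auto simp: S_def)
  moreover have "finite M" by (rule finite_subset[of _ "{?n - c}"]) (auto simp: M_def)
  moreover have "M \<inter> S p (c - int q) \<sigma> = {}" by (auto simp: M_def S_def)
  moreover have "(M \<union> S p (c - int q) \<sigma>) \<inter> ?R = {}" by (auto simp: M_def S_def)
  ultimately have "card (S (p + q + 1) c ?g) = card M + card (S p (c - int q) \<sigma>) + card ?R"
    by (simp add: card_Un_disjoint)
  moreover have "card ?R = card (S q (c + int p + 1) \<tau>)"
    by (rule card_image) (simp add: inj_on_def)
  moreover have "card M = Delta (p + q + 1) c (p + 1)"
  proof -
    have "M = (if 1 \<le> ?n - c \<and> ?n - c \<le> int p then {?n - c} else {})"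
      by (auto simp: M_def)
    then show ?thesis by (auto simp: Delta_def)
  qed
  ultimately show ?thesis by (simp add: DD_shift_def S_def)
qed

section \<open>The recurrence\<close>

text \<open>
  Since gluing is bijective and the exponent is additive, the generating function of the
  permutations with a prescribed position of the maximum factors.
\<close>

lemma sum_Av132_max_at:
  "(\<Sum>\<pi> | \<pi> \<in> Av132 (p + q + 1) \<and> \<pi> (int p + 1) = int (p + q + 1).
      [:0, 1:] ^ DD_shift (p + q + 1) c \<pi>) =
    ([:0, 1:] ^ Delta (p + q + 1) c (p + 1) *
      f_shift p (c - int q) * f_shift q (c + int p + 1) :: int poly)"
proof -
  let ?x = "[:0, 1:] :: int poly"
  have "(\<Sum>\<pi> | \<pi> \<in> Av132 (p + q + 1) \<and> \<pi> (int p + 1) = int (p + q + 1).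
          ?x ^ DD_shift (p + q + 1) c \<pi>) =
      (\<Sum>z\<in>Av132 p \<times> Av132 q. ?x ^ DD_shift (p + q + 1) c ((\<lambda>(\<sigma>, \<tau>). glue p q \<sigma> \<tau>) z))"
    by (rule sum.reindex_bij_betw[OF bij_betw_glue, symmetric])
  also have "\<dots> = (\<Sum>(\<sigma>, \<tau>)\<in>Av132 p \<times> Av132 q. ?x ^ Delta (p + q + 1) c (p + 1) *
      (?x ^ DD_shift p (c - int q) \<sigma> * ?x ^ DD_shift q (c + int p + 1) \<tau>))"
  proof (rule sum.cong[OF refl])
    fix z assume "z \<in> Av132 p \<times> Av132 q"
    then obtain \<sigma> \<tau> where z: "z = (\<sigma>, \<tau>)" "\<sigma> \<in> Av132 p" "\<tau> \<in> Av132 q" by blast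
    show "?x ^ DD_shift (p + q + 1) c ((\<lambda>(\<sigma>, \<tau>). glue p q \<sigma> \<tau>) z) =
        (case z of (\<sigma>, \<tau>) \<Rightarrow> ?x ^ Delta (p + q + 1) c (p + 1) *
          (?x ^ DD_shift p (c - int q) \<sigma> * ?x ^ DD_shift q (c + int p + 1) \<tau>))"
      unfolding z(1) prod.case DD_shift_glue[OF z(2,3)[THEN Av132_permutes]] power_add
      by (rule mult.assoc)
  qed
  also have "\<dots> = ?x ^ Delta (p + q + 1) c (p + 1) *
      f_shift p (c - int q) * f_shift q (c + int p + 1)"
    unfolding f_shift_def sum.cartesian_product[symmetric] mult.assoc
    by (subst sum_product) (simp only: sum_distrib_left)
  finally show ?thesis .
qed

lemma f_shift_recurrence:
  assumes "n \<ge> 1"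
  shows "f_shift n c = (\<Sum>i=1..n. [:0, 1:] ^ Delta n c i *
           f_shift (i - 1) (c - (int n - int i)) * f_shift (n - i) (c + int i))"
proof -
  let ?M = "\<lambda>i. {\<pi> \<in> Av132 n. \<pi> (int i) = int n}"
  have "\<exists>i\<in>{1..n}. \<pi> (int i) = int n" if "\<pi> \<in> Av132 n" for \<pi>
  proof -
    have "int n \<in> \<pi> ` {1..int n}"
      using assms permutes_image[OF Av132_permutes[OF that]] by simp
    then obtain j where "1 \<le> j" "j \<le> int n" "\<pi> j = int n" by auto
    then show ?thesis by (intro bexI[of _ "nat j"]) auto
  qed
  then have cover: "(\<Union>i\<in>{1..n}. ?M i) = Av132 n" by blast
  have "?M i \<inter> ?M j = {}" if "i \<noteq> j" for i j
  proof -
    have "int i = int j" if "\<pi> \<in> ?M i" "\<pi> \<in> ?M j" for \<pi>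
      by (rule injD[OF permutes_inj[OF Av132_permutes[of \<pi> n]]]) (use that in auto)
    with that show ?thesis by (metis (no_types, lifting) disjoint_iff of_nat_eq_iff)
  qed
  then have "(\<Sum>\<pi>\<in>(\<Union>i\<in>{1..n}. ?M i). [:0, 1:] ^ DD_shift n c \<pi>) =
      (\<Sum>i=1..n. \<Sum>\<pi>\<in>?M i. [:0, 1:] ^ DD_shift n c \<pi> :: int poly)"
    by (intro sum.UNION_disjoint) (auto simp: finite_Av132)
  then have "f_shift n c = (\<Sum>i=1..n. \<Sum>\<pi>\<in>?M i. [:0, 1:] ^ DD_shift n c \<pi>)"
    by (simp only: f_shift_def cover)
  also have "\<dots> = (\<Sum>i=1..n. [:0, 1:] ^ Delta n c i *
      f_shift (i - 1) (c - (int n - int i)) * f_shift (n - i) (c + int i))"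
  proof (rule sum.cong[OF refl])
    fix i assume "i \<in> {1..n}"
    then have "i - 1 + (n - i) + 1 = n" "int (i - 1) + 1 = int i" "i - 1 + 1 = i"
      "int (n - i) = int n - int i" "c + int (i - 1) + 1 = c + int i"
      by auto
    then show "(\<Sum>\<pi>\<in>?M i. [:0, 1:] ^ DD_shift n c \<pi>) = [:0, 1:] ^ Delta n c i *
        f_shift (i - 1) (c - (int n - int i)) * f_shift (n - i) (c + int i)"
      using sum_Av132_max_at[of "i - 1" "n - i" c] by (simp only:)
  qed
  finally show ?thesis .
qed

lemma f_shift_0: "f_shift 0 c = 1"
proof -
  have "Av132 0 = {id}" by (auto simp: Av132_iff)
  then show ?thesis by (simp add: f_shift_def DD_shift_def)
qed

lemma DD_shift_zero: "DD_shift n 0 \<pi> = DD n \<pi>"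
  unfolding DD_shift_def DD_def by (rule arg_cong[where f = card]) auto

theorem proposition5:
  shows "(\<forall>n::nat. \<forall>c::int. n \<ge> 1 \<longrightarrow>
            f_shift n c = (\<Sum>i=1..n. [:0, 1:] ^ Delta n c i *
                       f_shift (i - 1) (c - (int n - int i)) * f_shift (n - i) (c + int i))) \<and>
         (\<forall>c::int. f_shift 0 c = 1) \<and>
         (\<forall>n::nat. f132 n = f_shift n 0)"
proof (intro conjI allI impI)
  show "f132 n = f_shift n 0" for n
    by (simp add: f132_def f_shift_def DD_shift_zero)
qed (rule f_shift_recurrence f_shift_0, assumption?)+

end
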